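(* Let $\epsilon>0$, let $\mathbf{K}=\exp(-\mathbf{C}/\epsilon)$ with $$\mathbf{C}_{i_0\dots i_{\mathcal{T}}}=\sum_{t=2}^{\mathcal{T}-1}(C_L)_{i_0i_t}+\sum_{t=1}^{\mathcal{T}-1}C_{i_ti_{t+1}},$$ and let $$\mathbf{U}_{i_0\dots i_{\mathcal{T}}}=U^{(0,1)}_{i_0i_1}\,U^{(0,\mathcal{T})}_{i_0i_{\mathcal{T}}}\prod_{t=2}^{\mathcal{T}-1}(u_t)_{i_t}.$$ With the matrices $K_L=\exp(-C_L/\epsilon)$ and $K=\exp(-C/\epsilon)$, define $$\hat\Psi_t=\begin{cases}U^{(0,1)}K, & t=2,\\ \big(\hat\Psi_{t-1}\odot K_L\big)\,\mathrm{diag}(u_{t-1})\,K, & t=3,\dots,\mathcal{T},\end{cases}$$ and $$\Psi_t=\begin{cases}U^{(0,\mathcal{T})}K^T, & t=\mathcal{T}-1,\\ \big(\Psi_{t+1}\odot K_L\big)\,\mathrm{diag}(u_{t+1})\,K^T, & t=1,\dots,\mathcal{T}-2.\end{cases}$$ Then the bi-marginal projections of the tensor $\mathbf{K}\odot\mathbf{U}$ are $$\begin{aligned}P_{0,1}(\mathbf{K}\odot\mathbf{U})&=U^{(0,1)}\odot\Psi_1,\\ P_{0,\mathcal{T}}(\mathbf{K}\odot\mathbf{U})&=U^{(0,\mathcal{T})}\odot\hat\Psi_{\mathcal{T}},\\ P_{0,t}(\mathbf{K}\odot\mathbf{U})&=\big(\hat\Psi_t\odot\Psi_t\odot K_L\big)\,\mathrm{diag}(u_t),\quad\text{for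 } t=2,\dots,\mathcal{T}-1.\end{aligned}$$
   Context: $\mathcal{T}\ge 2$, $L,n$ are positive integers. $C_L\in\mathbb{R}^{L\times n}$, and $C\in\overline{\mathbb{R}}_+^{n\times n}$ where $\overline{\mathbb{R}}_+=[0,\infty)\cup\{\infty\}$ and $\exp(-\infty)=0$. $U^{(0,1)},U^{(0,\mathcal{T})}\in\mathbb{R}_+^{L\times n}$ and $u_t\in\mathbb{R}_+^n$ for $t=2,\dots,\mathcal{T}-1$. Tensors have $\mathcal{T}+1$ modes, with $i_0\in\{1,\dots,L\}$ and $i_1,\dots,i_{\mathcal{T}}\in\{1,\dots,n\}$. $\odot$ is the elementwise product and $\exp$ is applied elementwise; $\mathrm{diag}(u)$ is the diagonal matrix with diagonal $u$. The bi-marginal projection is $(P_{0,t}(\mathbf{M}))_{i_0i_t}=\sum\mathbf{M}_{i_0\dots i_{\mathcal{T}}}$, where the sum is over all indices except $i_0$ and $i_t$. *)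

theory Defs
  imports "HOL-Analysis.Analysis"
begin

text \<open>
  The index \<open>i\<^sub>0\<close> ranges over the finite type \<open>'l\<close> (of cardinality \<open>L\<close>), and each of
  \<open>i\<^sub>1, \<dots>, i\<^sub>T\<close> over the finite type \<open>'n\<close> (of cardinality \<open>n\<close>). Since the number of modes
  varies, \<open>(i\<^sub>1, \<dots>, i\<^sub>T)\<close> is an extensional function on \<open>{1..T}\<close>; only such functions are
  indices of a tensor with \<open>T + 1\<close> modes.
\<close>

type_synonym ('a, 'l, 'n) tensor = "'l \<Rightarrow> (nat \<Rightarrow> 'n) \<Rightarrow> 'a"

definition multi_indices :: "nat \<Rightarrow> (nat \<Rightarrow> 'n) set" where
  "multi_indices T = (\<Pi>\<^sub>E t\<in>{1..T}. UNIV)"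

text \<open>The value at \<open>\<infinity>\<close> is a dummy: the function is only applied to arguments below \<open>\<infinity>\<close>.\<close>

definition exp_ereal :: "ereal \<Rightarrow> real" where
  "exp_ereal x = (if x = -\<infinity> then 0 else exp (real_of_ereal x))"

definition hadamard :: "real^'n^'m \<Rightarrow> real^'n^'m \<Rightarrow> real^'n^'m"  (infixl "\<odot>" 70) where
  "A \<odot> B = (\<chi> i j. A $ i $ j * B $ i $ j)"

definition hadamard_tensor ::
    "(real, 'l, 'n) tensor \<Rightarrow> (real, 'l, 'n) tensor \<Rightarrow> (real, 'l, 'n) tensor"
    (infixl "\<odot>\<^sub>T" 70) where
  "M \<odot>\<^sub>T N = (\<lambda>i0 i. M i0 i * N i0 i)"

definition diag :: "real^'n \<Rightarrow> real^'n^'n" where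
  "diag v = (\<chi> i j. if i = j then v $ i else 0)"

definition gibbs_matrix :: "real \<Rightarrow> ereal^'n^'m \<Rightarrow> real^'n^'m" where
  "gibbs_matrix \<epsilon> A = (\<chi> i j. exp_ereal (- (A $ i $ j) / ereal \<epsilon>))"

definition gibbs_matrix_real :: "real \<Rightarrow> real^'n^'m \<Rightarrow> real^'n^'m" where
  "gibbs_matrix_real \<epsilon> A = (\<chi> i j. exp (- (A $ i $ j) / \<epsilon>))"

definition gibbs_tensor :: "real \<Rightarrow> (ereal, 'l, 'n) tensor \<Rightarrow> (real, 'l, 'n) tensor" where
  "gibbs_tensor \<epsilon> M = (\<lambda>i0 i. exp_ereal (- M i0 i / ereal \<epsilon>))"

definition cost_tensor ::
    "nat \<Rightarrow> real^'n^'l \<Rightarrow> ereal^'n^'n \<Rightarrow> (ereal, 'l, 'n) tensor" where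
  "cost_tensor T CL C = (\<lambda>i0 i.
     (\<Sum>t=2..T - 1. ereal (CL $ i0 $ i t)) + (\<Sum>t=1..T - 1. C $ i t $ i (t + 1)))"

definition scaling_tensor ::
    "nat \<Rightarrow> real^'n^'l \<Rightarrow> real^'n^'l \<Rightarrow> (nat \<Rightarrow> real^'n) \<Rightarrow> (real, 'l, 'n) tensor" where
  "scaling_tensor T U01 U0T u = (\<lambda>i0 i.
     U01 $ i0 $ i 1 * U0T $ i0 $ i T * (\<Prod>t=2..T - 1. u t $ i t))"

definition bimarginal :: "nat \<Rightarrow> nat \<Rightarrow> (real, 'l, 'n) tensor \<Rightarrow> real^'n^'l" where
  "bimarginal T t M = (\<chi> i0 j. \<Sum>i\<in>{i \<in> multi_indices T. i t = j}. M i0 i)"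

text \<open>
  \<open>Psi_hat \<dots> t\<close> is meaningful for \<open>2 \<le> t \<le> T\<close> and \<open>Psi T \<dots> t\<close> for \<open>1 \<le> t \<le> T - 1\<close>;
  outside these ranges they are dummies.
\<close>

fun Psi_hat ::
    "real^'n^'l \<Rightarrow> real^'n^'n \<Rightarrow> real^'n^'l \<Rightarrow> (nat \<Rightarrow> real^'n) \<Rightarrow> nat \<Rightarrow> real^'n^'l" where
  "Psi_hat KL K U01 u t =
     (if t \<le> 2 then U01 ** K
      else (Psi_hat KL K U01 u (t - 1) \<odot> KL) ** diag (u (t - 1)) ** K)"

declare Psi_hat.simps [simp del]

function Psi ::
    "nat \<Rightarrow> real^'n^'l \<Rightarrow> real^'n^'n \<Rightarrow> real^'n^'l \<Rightarrow> (nat \<Rightarrow> real^'n) \<Rightarrow> nat \<Rightarrow> real^'n^'l"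
    where
  "Psi T KL K U0T u t =
     (if T - 1 \<le> t then U0T ** transpose K
      else (Psi T KL K U0T u (t + 1) \<odot> KL) ** diag (u (t + 1)) ** transpose K)"
  by pat_completeness auto
termination
  by (relation "Wellfounded.measure (\<lambda>(T, _, _, _, _, t). T - t)") auto

declare Psi.simps [simp del]

end

theory Submission
  imports Defs
begin

text \<open>
  For fixed \<open>i\<^sub>0\<close> the entry of \<open>\<^bold>K \<odot> \<^bold>U\<close> factors along the path \<open>i\<^sub>1, \<dots>, i\<^sub>T\<close> into a kernel
  factor for each step and a weight for each node. The sum over all paths is taken by
  absorbing the last node into the terminal function, one node at a time: first down to
  the marked node \<open>t\<close>, which builds up the backward message (\<open>\<Psi>\<^sub>t\<close> times the weight at \<open>t\<close>),
  and then down to node \<open>1\<close>, which builds up the forward message \<open>\<Psi>\<close>-hat.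
\<close>

section \<open>Exponentials of extended-real sums\<close>

lemma sum_ereal_neq_MInfty:
  fixes f :: "'a \<Rightarrow> ereal"
  assumes "\<And>a. a \<in> A \<Longrightarrow> f a \<noteq> -\<infinity>"
  shows "(\<Sum>a\<in>A. f a) \<noteq> -\<infinity>"
  using assms by (induction A rule: infinite_finite_induct) auto

text \<open>An infinite summand makes both sides 0. A summand \<open>-\<infinity>\<close> is
  excluded because it leads to the dummy value 1 of \<open>exp_ereal\<close> at
  \<open>\<infinity>\<close>.\<close>

lemma exp_ereal_add:
  assumes "x \<noteq> -\<infinity>" "y \<noteq> -\<infinity>" "\<epsilon> > 0"
  shows "exp_ereal (- (x + y) / ereal \<epsilon>) = exp_ereal (- x / ereal \<epsilon>) * exp_ereal (- y / ereal \<epsilon>)"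
  using assms
  by (cases x; cases y) (auto simp: exp_ereal_def field_simps simp flip: exp_add)

lemma exp_ereal_sum:
  assumes "finite A" "\<And>a. a \<in> A \<Longrightarrow> f a \<noteq> -\<infinity>" "\<epsilon> > 0"
  shows "exp_ereal (- (\<Sum>a\<in>A. f a) / ereal \<epsilon>) = (\<Prod>a\<in>A. exp_ereal (- f a / ereal \<epsilon>))"
  using assms
proof (induction A rule: finite_induct)
  case empty
  then show ?case by (simp add: exp_ereal_def zero_ereal_def)
next
  case (insert a A)
  then have "(\<Sum>a\<in>A. f a) \<noteq> -\<infinity>"
    by (intro sum_ereal_neq_MInfty) auto
  moreover have "f a \<noteq> -\<infinity>"
    using insert.prems by simp
  moreover have "exp_ereal (- (\<Sum>a\<in>A. f a) / ereal \<epsilon>) = (\<Prod>a\<in>A. exp_ereal (- f a / ereal \<epsilon>))"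
    using insert.IH insert.prems by simp
  ultimately show ?case
    using insert.hyps assms(3)
    by (simp only: sum.insert prod.insert exp_ereal_add not_False_eq_True)
qed

text \<open>Turns additive costs into kernel factors, even where \<open>C\<close> is infinite:
  nonnegativity rules out \<open>-\<infinity>\<close>, so \<open>exp_ereal_add\<close>
  applies.\<close>

lemma gibbs_tensor_cost_tensor:
  assumes "\<epsilon> > 0" "\<forall>i j. 0 \<le> C $ i $ j"
  shows "gibbs_tensor \<epsilon> (cost_tensor T CL C) i0 i =
    (\<Prod>t=2..T - 1. gibbs_matrix_real \<epsilon> CL $ i0 $ i t) *
    (\<Prod>t=1..T - 1. gibbs_matrix \<epsilon> C $ i t $ i (t + 1))"
proof -
  have C: "C $ a $ b \<noteq> -\<infinity>" for a b
    using assms(2)[rule_format, of a b] by auto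
  have "(\<Sum>t=2..T - 1. ereal (CL $ i0 $ i t)) \<noteq> -\<infinity>"
    "(\<Sum>t=1..T - 1. C $ i t $ i (t + 1)) \<noteq> -\<infinity>"
    using C by (auto intro!: sum_ereal_neq_MInfty)
  then have "gibbs_tensor \<epsilon> (cost_tensor T CL C) i0 i =
      (\<Prod>t=2..T - 1. exp_ereal (- ereal (CL $ i0 $ i t) / ereal \<epsilon>)) *
      (\<Prod>t=1..T - 1. exp_ereal (- C $ i t $ i (t + 1) / ereal \<epsilon>))"
    unfolding gibbs_tensor_def cost_tensor_def
    using assms(1) C
    by (subst exp_ereal_add, simp, simp, simp)
      (subst exp_ereal_sum, simp, simp, simp, subst exp_ereal_sum, auto)
  then show ?thesis
    using assms(1) by (simp add: gibbs_matrix_real_def gibbs_matrix_def exp_ereal_def)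
qed

section \<open>Matrix entries\<close>

lemma hadamard_nth [simp]: "(A \<odot> B) $ i $ j = A $ i $ j * B $ i $ j"
  by (simp add: hadamard_def)

lemma matrix_mult_nth: "(A ** B) $ i $ j = (\<Sum>k\<in>UNIV. A $ i $ k * B $ k $ j)"
  by (simp add: matrix_matrix_mult_def)

lemma matrix_mult_diag_nth [simp]: "(A ** diag v) $ i $ j = A $ i $ j * v $ j"
proof -
  have "(A ** diag v) $ i $ j = (\<Sum>k\<in>UNIV. if k = j then A $ i $ k * v $ k else 0)"
    unfolding matrix_mult_nth diag_def by (intro sum.cong) auto
  then show ?thesis by simp
qed

section \<open>Messages and sums over paths\<close>

text \<open>\<open>fwd k w m\<close> is the message arriving at node \<open>m + 1\<close> from nodes \<open>1, \<dots>, m\<close>;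
  \<open>bwd k w \<psi> n t\<close> is the message at node \<open>t\<close>, its own weight included, from the terminal
  function \<open>\<psi>\<close> at node \<open>t + n\<close>.\<close>

primrec fwd :: "('n::finite \<Rightarrow> 'n \<Rightarrow> real) \<Rightarrow> (nat \<Rightarrow> 'n \<Rightarrow> real) \<Rightarrow> nat \<Rightarrow> 'n \<Rightarrow> real" where
  "fwd k w 0 j = 1"
| "fwd k w (Suc m) j = (\<Sum>a\<in>UNIV. fwd k w m a * w (Suc m) a * k a j)"

primrec bwd :: "('n::finite \<Rightarrow> 'n \<Rightarrow> real) \<Rightarrow> (nat \<Rightarrow> 'n \<Rightarrow> real) \<Rightarrow> ('n \<Rightarrow> real) \<Rightarrow>
    nat \<Rightarrow> nat \<Rightarrow> 'n \<Rightarrow> real" where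
  "bwd k w \<psi> 0 t j = \<psi> j"
| "bwd k w \<psi> (Suc n) t j = w t j * (\<Sum>a\<in>UNIV. k j a * bwd k w \<psi> n (Suc t) a)"

text \<open>Both sides compose the one-step operators of nodes \<open>t\<close> to
  \<open>t + n\<close>. The recursion of \<open>bwd\<close> peels off the first; this form peels off
  the last, the end at which paths are shortened.\<close>

lemma bwd_Suc_terminal:
  "bwd k w \<psi> (Suc n) t = bwd k w (\<lambda>j. w (t + n) j * (\<Sum>a\<in>UNIV. k j a * \<psi> a)) n t"
proof (induction n arbitrary: t)
  case 0
  then show ?case by (simp add: fun_eq_iff)
next
  case (Suc n)
  then show ?case
    by (subst bwd.simps(2), subst Suc.IH) (simp add: fun_eq_iff)
qed

lemma sum_multi_indices_Suc:
  fixes g :: "(nat \<Rightarrow> 'n::finite) \<Rightarrow> real"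
  shows "(\<Sum>i\<in>multi_indices (Suc T). g i) =
    (\<Sum>i\<in>multi_indices T. \<Sum>a\<in>UNIV. g (i(Suc T := a)))"
proof -
  have "multi_indices (Suc T) =
      (\<lambda>(a, i). i(Suc T := a)) ` (UNIV \<times> (multi_indices T :: (nat \<Rightarrow> 'n) set))"
    unfolding multi_indices_def by (simp add: atLeastAtMostSuc_conv PiE_insert_eq)
  \<comment> \<open>Extensional functions on \<open>{1..T}\<close> all agree at
    \<open>Suc T\<close>, so the update loses no information.\<close>
  moreover have "inj_on (\<lambda>(a, i). i(Suc T := a)) (UNIV \<times> (multi_indices T :: (nat \<Rightarrow> 'n) set))"
    unfolding multi_indices_def using inj_combinator[of "Suc T" "{1..T}" "\<lambda>_. UNIV"] by simp
  ultimately have "(\<Sum>i\<in>multi_indices (Suc T). g i) =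
      (\<Sum>(a, i)\<in>UNIV \<times> multi_indices T. g (i(Suc T := a)))"
    by (simp add: sum.reindex case_prod_unfold)
  also have "\<dots> = (\<Sum>a\<in>UNIV. \<Sum>i\<in>multi_indices T. g (i(Suc T := a)))"
    by (simp add: sum.cartesian_product)
  finally show ?thesis
    by (simp add: sum.swap[of _ UNIV])
qed

text \<open>The \<open>m\<close> steps visit \<open>m + 1\<close> nodes; the last carries no weight,
  which leaves room for a terminal function.\<close>

definition path_weight ::
    "('n \<Rightarrow> 'n \<Rightarrow> real) \<Rightarrow> (nat \<Rightarrow> 'n \<Rightarrow> real) \<Rightarrow> nat \<Rightarrow> (nat \<Rightarrow> 'n) \<Rightarrow> real" where
  "path_weight k w m i = (\<Prod>s=1..m. w s (i s) * k (i s) (i (Suc s)))"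

lemma path_weight_Suc_update:
  "path_weight k w (Suc m) (i(Suc (Suc m) := a)) =
    path_weight k w m i * (w (Suc m) (i (Suc m)) * k (i (Suc m)) a)"
proof -
  have "path_weight k w m (i(Suc (Suc m) := a)) = path_weight k w m i"
    unfolding path_weight_def by (intro prod.cong) auto
  then show ?thesis
    by (simp add: path_weight_def)
qed

text \<open>Summing out the last node turns \<phi> into a new function of the node before it, so the
  induction keeps \<phi> arbitrary.\<close>

lemma sum_paths_forward:
  "(\<Sum>i\<in>multi_indices (Suc m). path_weight k w m i * \<phi> (i (Suc m))) =
    (\<Sum>j\<in>UNIV. fwd k w m j * \<phi> j)"
proof (induction m arbitrary: \<phi>)
  case 0
  have "(multi_indices 0 :: (nat \<Rightarrow> 'a) set) = {\<lambda>_. undefined}"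
    by (simp add: multi_indices_def)
  then show ?case
    by (subst sum_multi_indices_Suc) (simp add: path_weight_def)
next
  case (Suc m)
  have "(\<Sum>i\<in>multi_indices (Suc (Suc m)). path_weight k w (Suc m) i * \<phi> (i (Suc (Suc m)))) =
      (\<Sum>i\<in>multi_indices (Suc m). path_weight k w m i *
        (\<Sum>a\<in>UNIV. w (Suc m) (i (Suc m)) * k (i (Suc m)) a * \<phi> a))"
    by (subst sum_multi_indices_Suc)
      (simp add: path_weight_Suc_update sum_distrib_left mult.assoc)
  also have "\<dots> = (\<Sum>j\<in>UNIV. fwd k w m j * (\<Sum>a\<in>UNIV. w (Suc m) j * k j a * \<phi> a))"
    by (rule Suc.IH)
  also have "\<dots> = (\<Sum>a\<in>UNIV. fwd k w (Suc m) a * \<phi> a)"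
    \<comment> \<open>Interchanging the sums moves the step from the terminal function into
      \<open>fwd\<close>.\<close>
    unfolding fwd.simps sum_distrib_left sum_distrib_right
    by (subst sum.swap) (simp add: mult.assoc)
  finally show ?case .
qed

text \<open>Induction on the distance \<open>n\<close> from the marked node \<open>Suc m\<close> to
  the end: \<psi> absorbs the last node while \<phi> stays at the marked one.\<close>

lemma sum_paths:
  "(\<Sum>i\<in>multi_indices (Suc (m + n)).
      path_weight k w (m + n) i * \<psi> (i (Suc (m + n))) * \<phi> (i (Suc m))) =
    (\<Sum>j\<in>UNIV. fwd k w m j * bwd k w \<psi> n (Suc m) j * \<phi> j)"
proof (induction n arbitrary: \<psi>)
  case 0
  \<comment> \<open>The marked node is now the last, so \<psi> and \<phi> merge into one terminal
    function.\<close>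
  show ?case
    using sum_paths_forward[of k w m "\<lambda>j. \<psi> j * \<phi> j"] by (simp add: mult.assoc)
next
  case (Suc n)
  define \<psi>' where "\<psi>' = (\<lambda>j. w (Suc m + n) j * (\<Sum>a\<in>UNIV. k j a * \<psi> a))"
  have "(\<Sum>i\<in>multi_indices (Suc (m + Suc n)).
      path_weight k w (m + Suc n) i * \<psi> (i (Suc (m + Suc n))) * \<phi> (i (Suc m))) =
    (\<Sum>i\<in>multi_indices (Suc (m + n)).
      path_weight k w (m + n) i * \<psi>' (i (Suc (m + n))) * \<phi> (i (Suc m)))"
    unfolding add_Suc_right
    by (subst sum_multi_indices_Suc)
      (simp add: path_weight_Suc_update \<psi>'_def sum_distrib_left sum_distrib_right mult_ac)
  also have "\<dots> = (\<Sum>j\<in>UNIV. fwd k w m j * bwd k w \<psi>' n (Suc m) j * \<phi> j)"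
    by (rule Suc.IH)
  finally show ?case
    by (simp only: bwd_Suc_terminal \<psi>'_def)
qed

text \<open>Taking \<phi> as the indicator of \<open>j\<close> pins the marked node.\<close>

lemma sum_paths_through:
  "(\<Sum>i\<in>{i \<in> multi_indices (Suc (m + n)). i (Suc m) = j}.
      path_weight k w (m + n) i * \<psi> (i (Suc (m + n)))) =
    fwd k w m j * bwd k w \<psi> n (Suc m) j"
proof -
  have "finite (multi_indices (Suc (m + n)) :: (nat \<Rightarrow> 'a) set)"
    by (simp add: multi_indices_def finite_PiE)
  then show ?thesis
    using sum_paths[of k w m n \<psi> "\<lambda>a. if a = j then 1 else 0"]
    by (simp add: sum.inter_filter if_distrib cong: if_cong)
qed

section \<open>Identification of the messages with the matrix recursions\<close>

text \<open>Covers nodes 1 to \<open>T - 1\<close>; the factor \<open>U0T\<close> at node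
  \<open>T\<close> serves as the terminal function.\<close>

definition node_weight ::
    "real^'n^'l \<Rightarrow> real^'n^'l \<Rightarrow> (nat \<Rightarrow> real^'n) \<Rightarrow> 'l \<Rightarrow> nat \<Rightarrow> 'n \<Rightarrow> real" where
  "node_weight KL U01 u i0 t j = (if t \<le> 1 then U01 $ i0 $ j else KL $ i0 $ j * u t $ j)"

text \<open>The message from nodes \<open>1\<close> to \<open>Suc m\<close> arrives at node
  \<open>Suc (Suc m)\<close>; hence the index shift.\<close>

lemma fwd_eq_Psi_hat:
  "fwd (\<lambda>a b. K $ a $ b) (node_weight KL U01 u i0) (Suc m) j =
    Psi_hat KL K U01 u (Suc (Suc m)) $ i0 $ j"
proof (induction m arbitrary: j)
  case 0
  then show ?case
    by (simp add: Psi_hat.simps matrix_mult_nth node_weight_def)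
next
  case (Suc m)
  have "node_weight KL U01 u i0 (Suc (Suc m)) a = KL $ i0 $ a * u (Suc (Suc m)) $ a" for a
    by (simp add: node_weight_def)
  then show ?case
    by (subst fwd.simps(2), subst Psi_hat.simps, simp only: Suc.IH)
      (simp add: matrix_mult_nth[of _ K] mult.assoc)
qed

text \<open>Here \<open>T\<close> is \<open>t + Suc n\<close>, and \<open>Psi\<close> omits the
  weight of its own node. With \<open>t \<ge> 1\<close> the next node is at least 2, so its weight
  is the factor \<open>KL\<close> times \<open>u\<close> in the recursion of
  \<open>Psi\<close>.\<close>

lemma bwd_eq_Psi:
  assumes "t \<ge> 1"
  shows "bwd (\<lambda>a b. K $ a $ b) (node_weight KL U01 u i0) (\<lambda>j. U0T $ i0 $ j) (Suc n) t j =
    node_weight KL U01 u i0 t j * Psi (t + Suc n) KL K U0T u t $ i0 $ j"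
  using assms
proof (induction n arbitrary: t j)
  case 0
  then show ?case
    by (simp add: Psi.simps matrix_mult_nth transpose_def mult.commute)
next
  case (Suc n)
  have "bwd (\<lambda>a b. K $ a $ b) (node_weight KL U01 u i0) (\<lambda>j. U0T $ i0 $ j) (Suc (Suc n)) t j =
      node_weight KL U01 u i0 t j * (\<Sum>a\<in>UNIV. K $ j $ a *
        (node_weight KL U01 u i0 (Suc t) a * Psi (t + Suc (Suc n)) KL K U0T u (Suc t) $ i0 $ a))"
    by (subst bwd.simps) (simp only: Suc.IH le_SucI[OF Suc.prems] add_Suc_shift)
  also have "(\<Sum>a\<in>UNIV. K $ j $ a *
        (node_weight KL U01 u i0 (Suc t) a * Psi (t + Suc (Suc n)) KL K U0T u (Suc t) $ i0 $ a)) =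
      Psi (t + Suc (Suc n)) KL K U0T u t $ i0 $ j"
    using Suc.prems
    by (subst (2) Psi.simps)
      (simp add: matrix_mult_nth[of _ "transpose K"] node_weight_def, simp add: transpose_def mult_ac)
  finally show ?case .
qed

lemma path_weight_node_weight:
  assumes "T \<ge> 2"
  shows "path_weight k (node_weight KL U01 u i0) (T - 1) i =
    U01 $ i0 $ i 1 * (\<Prod>t=2..T - 1. KL $ i0 $ i t * u t $ i t) *
    (\<Prod>t=1..T - 1. k (i t) (i (t + 1)))"
proof -
  \<comment> \<open>Since \<open>T \<ge> 2\<close>, node 1 is in the range and can be split
    off.\<close>
  have "{1..T - 1} = insert 1 {2..T - 1}"
    using assms by auto
  then have "(\<Prod>t=1..T - 1. node_weight KL U01 u i0 t (i t)) =
      U01 $ i0 $ i 1 * (\<Prod>t=2..T - 1. node_weight KL U01 u i0 t (i t))"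
    by (simp add: node_weight_def)
  also have "(\<Prod>t=2..T - 1. node_weight KL U01 u i0 t (i t)) =
      (\<Prod>t=2..T - 1. KL $ i0 $ i t * u t $ i t)"
    by (intro prod.cong) (auto simp: node_weight_def)
  finally show ?thesis
    by (simp add: path_weight_def prod.distrib)
qed

theorem theorem5:
  fixes T :: nat
    and \<epsilon> :: real
    and CL KL U01 U0T :: "real ^ 'n ^ 'l"
    and C :: "ereal ^ 'n ^ 'n"
    and K :: "real ^ 'n ^ 'n"
    and u :: "nat \<Rightarrow> real ^ 'n"
    and KU :: "(real, 'l, 'n) tensor"
  assumes "T \<ge> 2"
    and "\<epsilon> > 0"
    and "\<forall>i j. 0 \<le> C $ i $ j"
    and "\<forall>i j. 0 \<le> U01 $ i $ j"
    and "\<forall>i j. 0 \<le> U0T $ i $ j"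
    and "\<forall>t\<in>{2..T - 1}. \<forall>j. 0 \<le> u t $ j"
    and "KL = gibbs_matrix_real \<epsilon> CL"
    and "K = gibbs_matrix \<epsilon> C"
    and "KU = gibbs_tensor \<epsilon> (cost_tensor T CL C) \<odot>\<^sub>T scaling_tensor T U01 U0T u"
  shows "bimarginal T 1 KU = U01 \<odot> Psi T KL K U0T u 1 \<and>
         bimarginal T T KU = U0T \<odot> Psi_hat KL K U01 u T \<and>
         (\<forall>t\<in>{2..T - 1}. bimarginal T t KU =
           (Psi_hat KL K U01 u t \<odot> Psi T KL K U0T u t \<odot> KL) ** diag (u t))"
proof -
  define k where "k = (\<lambda>a b. K $ a $ b)"
  define w where "w = node_weight KL U01 u"
  have KU: "KU i0 i = path_weight k (w i0) (T - 1) i * U0T $ i0 $ i T" for i0 i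
    unfolding w_def k_def path_weight_node_weight[OF assms(1)] assms(9)
      hadamard_tensor_def scaling_tensor_def gibbs_tensor_cost_tensor[OF assms(2,3)]
      assms(7,8)[symmetric] prod.distrib
    by (simp only: mult_ac)
  \<comment> \<open>\<open>sum_paths_through\<close> with \<open>t - 1\<close> steps before the
    marked node and \<open>T - t\<close> after it.\<close>
  have marginal: "bimarginal T t KU $ i0 $ j =
      fwd k (w i0) (t - 1) j * bwd k (w i0) (\<lambda>j. U0T $ i0 $ j) (T - t) t j"
    if "1 \<le> t" "t \<le> T" for t i0 j
    using sum_paths_through[of k "w i0" "t - 1" "T - t" "\<lambda>j. U0T $ i0 $ j" j] that
    by (simp add: bimarginal_def KU)
  have bwd: "bwd k (w i0) (\<lambda>j. U0T $ i0 $ j) (T - t) t j =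
      w i0 t j * Psi T KL K U0T u t $ i0 $ j"
    if "1 \<le> t" "t < T" for t i0 j
    using bwd_eq_Psi[of t K KL U01 u i0 U0T "T - t - 1" j] that
    by (simp add: k_def w_def Suc_diff_Suc del: bwd.simps)
  have fwd: "fwd k (w i0) (t - 1) j = Psi_hat KL K U01 u t $ i0 $ j" if "2 \<le> t" for t i0 j
    using fwd_eq_Psi_hat[of K KL U01 u i0 "t - 2" j] that
    by (simp add: k_def w_def numeral_2_eq_2 Suc_diff_Suc del: fwd.simps)
  \<comment> \<open>At node 1 the forward message is the constant 1 and the weight is
    \<open>U01\<close>.\<close>
  have "bimarginal T 1 KU = U01 \<odot> Psi T KL K U0T u 1"
    using assms(1) bwd[of 1] by (simp add: vec_eq_iff marginal w_def node_weight_def)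
  \<comment> \<open>At node \<open>T\<close> the backward message is the terminal function
    \<open>U0T\<close> itself.\<close>
  moreover have "bimarginal T T KU = U0T \<odot> Psi_hat KL K U01 u T"
    using assms(1) fwd[of T] by (simp add: vec_eq_iff marginal)
  moreover have "bimarginal T t KU =
      (Psi_hat KL K U01 u t \<odot> Psi T KL K U0T u t \<odot> KL) ** diag (u t)" if "t \<in> {2..T - 1}" for t
  proof -
    have "2 \<le> t" "1 \<le> t" "t < T" "t \<le> T"
      using that assms(1) by auto
    then show ?thesis
      by (simp only: vec_eq_iff marginal fwd bwd) (simp add: w_def node_weight_def)
  qed
  ultimately show ?thesis
    by blast
qed

end
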